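(* For each $i\in N$, let $f_i:X\times X\times X_i\to 2^{Y_i}$ be a correspondence with nonempty values. For each $i\in N$, suppose that: a) $A_i,F_i$ have nonempty, convex values and open lower sections; b) $f_i(\cdot,x_i,\cdot,y_i,\cdot):X_{-i}\times X_{-i}\times X_i\to 2^{Y_i}$ is lower semicontinuous for each $(x_i,y_i)\in X_i\times X_i$; c) the correspondence $W_i:X_{-i}\to 2^{Y_i}$, defined by $W_i(x_{-i})=Y_i\setminus(-\mathrm{int}\,C_i(x_{-i}))$ for each $x_{-i}\in X_{-i}$, is upper semicontinuous; d) for each $(x_{-i},y_{-i})\in X_{-i}\times X_{-i}$ there exists $(x_i,y_i)\in A_i(x_{-i})\times F_i(y_{-i})$ such that $f_i(x,y,u_i)\cap\mathrm{int}\,C_i(x_{-i})\neq\emptyset$ for each $u_i\in\overline{A}_i(x_{-i})$; e) for each $(x_{-i},y_{-i},u_i)\in X_{-i}\times X_{-i}\times X_i$, $f_i(x_{-i},\cdot,y_{-i},\cdot,u_i):X_i\times X_i\to 2^{Y_i}$ is natural $\mathrm{int}\,C_i(x_{-i})$-quasi-concave. Then there exists a pair $(x^*,y^* )\in X\times X$ such that for each $i\in N$, $x_i^*\in A_i(x^*_{-i})$, $y_i^*\in F_i(y^*_{-i})$ and $f_i(x^*,y^*,u_i)\cap C_i(x^*_{-i})\neq\emptyset$ for each $u_i\in A_i(x^*_{-i})$.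
   Context: Setting. $N=\{1,\dots,n\}$ is finite. For each $i\in N$, $X_i$ is a nonempty convex compact subset of a Hausdorff locally convex space $E_i$ and $Y_i$ is a topological vector space. $X=\prod_{i\in N}X_i$, $X_{-i}=\prod_{j\neq i}X_j$; for $x\in X$ write $x=(x_{-i},x_i)$, and similarly $y=(y_{-i},y_i)$; $f_i(x,y,u_i)$ is also written $f_i(x_{-i},x_i,y_{-i},y_i,u_i)$. A correspondence is a set-valued map. For each $i\in N$, $A_i,F_i:X_{-i}\to 2^{X_i}$ and $C_i:X_{-i}\to 2^{Y_i}$ are correspondences with nonempty values, and for each $x_{-i}\in X_{-i}$, $C_i(x_{-i})$ is a proper, closed and convex cone with $\mathrm{int}\,C_i(x_{-i})\neq\emptyset$. Definitions. For a correspondence $T:U\to 2^V$ between topological spaces: $T$ has open lower sections if $\{u\in U:v\in T(u)\}$ is open for each $v\in V$; $T$ is upper (resp. lower) semicontinuous if for each $u\in U$ and each open $O\subset V$ with $T(u)\subset O$ (resp. $T(u)\cap O\neq\emptyset$) there is an open neighborhood $U'$ of $u$ with $T(u')\subset O$ (resp. $T(u')\cap O\neq\emptyset$) for all $u'\in U'$; $\overline{T}(u)=\{v\in V:(u,v)\in\mathrm{cl}_{U\times V}\,\mathrm{Gr}\,T\}$. For $K$ convex, $Y$ a topological vector space and $D\subset Y$, a correspondence $G:K\to 2^Y$ is natural $D$-quasi-concave if for any $k_1,k_2\in K$, $\lambda\in[0,1]$, $z_1\in G(k_1)$ and $z_2\in G(k_2)$ there exists $z\in G(\lambda k_1+(1-\lambda)k_2)$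 such that $z\in\mathrm{co}\{z_1,z_2\}+D$. *)

theory Defs
  imports "HOL-Analysis.Analysis"
begin

text \<open>
  A family of topological vector spaces is a family of topologies
  \<open>T\<^sub>1, \<dots>, T\<^sub>n\<close> whose carriers are linear subspaces of one real vector space without
  topology.  Any family of vector spaces embeds linearly into its direct sum, and each carrier
  has its own topology, so this does not restrict the spaces.
\<close>

definition tvs_topology :: "'a::real_vector topology \<Rightarrow> bool" where
  "tvs_topology T \<longleftrightarrow>
     subspace (topspace T) \<and>
     continuous_map (prod_topology T T) T (\<lambda>(x, y). x + y) \<and>
     continuous_map (prod_topology euclideanreal T) T (\<lambda>(c, x). c *\<^sub>R x)"

definition locally_convex_topology :: "'a::real_vector topology \<Rightarrow> bool" where
  "locally_convex_topology T \<longleftrightarrow> tvs_topology T \<and> neighbourhood_base_at 0 convex T"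

definition correspondence :: "'u set \<Rightarrow> 'v set \<Rightarrow> ('u \<Rightarrow> 'v set) \<Rightarrow> bool" where
  "correspondence U V T \<longleftrightarrow> (\<forall>u\<in>U. T u \<subseteq> V)"

definition nonempty_values :: "'u set \<Rightarrow> ('u \<Rightarrow> 'v set) \<Rightarrow> bool" where
  "nonempty_values U T \<longleftrightarrow> (\<forall>u\<in>U. T u \<noteq> {})"

definition convex_values :: "'u set \<Rightarrow> ('u \<Rightarrow> 'v::real_vector set) \<Rightarrow> bool" where
  "convex_values U T \<longleftrightarrow> (\<forall>u\<in>U. convex (T u))"

definition open_lower_sections :: "'u topology \<Rightarrow> 'v topology \<Rightarrow> ('u \<Rightarrow> 'v set) \<Rightarrow> bool" where
  "open_lower_sections U V T \<longleftrightarrow>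
     (\<forall>v\<in>topspace V. openin U {u \<in> topspace U. v \<in> T u})"

definition upper_semicontinuous :: "'u topology \<Rightarrow> 'v topology \<Rightarrow> ('u \<Rightarrow> 'v set) \<Rightarrow> bool" where
  "upper_semicontinuous U V T \<longleftrightarrow>
     (\<forall>u\<in>topspace U. \<forall>G. openin V G \<and> T u \<subseteq> G \<longrightarrow>
        (\<exists>U'. openin U U' \<and> u \<in> U' \<and> (\<forall>u'\<in>U'. T u' \<subseteq> G)))"

definition lower_semicontinuous :: "'u topology \<Rightarrow> 'v topology \<Rightarrow> ('u \<Rightarrow> 'v set) \<Rightarrow> bool" where
  "lower_semicontinuous U V T \<longleftrightarrow>
     (\<forall>u\<in>topspace U. \<forall>G. openin V G \<and> T u \<inter> G \<noteq> {} \<longrightarrow>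
        (\<exists>U'. openin U U' \<and> u \<in> U' \<and> (\<forall>u'\<in>U'. T u' \<inter> G \<noteq> {})))"

definition graph_closure ::
    "'u topology \<Rightarrow> 'v topology \<Rightarrow> ('u \<Rightarrow> 'v set) \<Rightarrow> 'u \<Rightarrow> 'v set" where
  "graph_closure U V T u =
     {v \<in> topspace V. (u, v) \<in> prod_topology U V closure_of (SIGMA u : topspace U. T u)}"

definition natural_quasi_concave ::
    "'k::real_vector set \<Rightarrow> 'y::real_vector set \<Rightarrow> ('k \<Rightarrow> 'y set) \<Rightarrow> bool" where
  "natural_quasi_concave K D G \<longleftrightarrow>
     (\<forall>k1\<in>K. \<forall>k2\<in>K. \<forall>l\<in>{0..1::real}. \<forall>z1\<in>G k1. \<forall>z2\<in>G k2.
        \<exists>z\<in>G (l *\<^sub>R k1 + (1 - l) *\<^sub>R k2). z \<in> {c + d | c d. c \<in> convex hull {z1, z2} \<and> d \<in> D})"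

text \<open>
  The product \<open>X\<close> is the set of extensional functions on \<open>{1..n}\<close>, and \<open>X\<^sub>-\<^sub>i\<close>
  that on \<open>{1..n} - {i}\<close>.  So \<open>x\<^sub>-\<^sub>i\<close> is a restriction of \<open>x\<close>, and the profile
  \<open>(p, t)\<close> made of \<open>p \<in> X\<^sub>-\<^sub>i\<close> and \<open>t \<in> X\<^sub>i\<close> is the update \<open>p(i := t)\<close>.
\<close>

definition profiles :: "nat \<Rightarrow> (nat \<Rightarrow> 'a set) \<Rightarrow> (nat \<Rightarrow> 'a) set" where
  "profiles n X = (\<Pi>\<^sub>E j\<in>{1..n}. X j)"

definition others :: "nat \<Rightarrow> (nat \<Rightarrow> 'a set) \<Rightarrow> nat \<Rightarrow> (nat \<Rightarrow> 'a) set" where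
  "others n X i = (\<Pi>\<^sub>E j\<in>{1..n} - {i}. X j)"

definition others_topology ::
    "nat \<Rightarrow> (nat \<Rightarrow> 'a topology) \<Rightarrow> (nat \<Rightarrow> 'a set) \<Rightarrow> nat \<Rightarrow> (nat \<Rightarrow> 'a) topology" where
  "others_topology n E X i = product_topology (\<lambda>j. subtopology (E j) (X j)) ({1..n} - {i})"

definition drop_coord :: "nat \<Rightarrow> nat \<Rightarrow> (nat \<Rightarrow> 'a) \<Rightarrow> nat \<Rightarrow> 'a" where
  "drop_coord n i x = restrict x ({1..n} - {i})"

end

theory Submission
  imports Defs
begin

text \<open>
  Given the strategies of the others in both profiles, call a pair \<open>(s, t)\<close> of player \<open>i\<close> a
  secure reply if it lies in \<open>A\<^sub>i \<times> F\<^sub>i\<close> and the value of \<open>f\<^sub>i\<close> meets the interior of the cone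
  \<open>C\<^sub>i\<close> for every \<open>u\<close> in the closure of \<open>A\<^sub>i\<close> (and not merely in \<open>A\<^sub>i\<close>).  A pair of
  profiles in which every player uses a secure reply is a solution, because \<open>A\<^sub>i\<close> lies in its
  closure and \<open>int C\<^sub>i\<close> in \<open>C\<^sub>i\<close>.  So a fixed point of the secure reply correspondence is wanted.  The
  values of this correspondence are nonempty by hypothesis.

  They are convex (\<open>convex_secure_replies\<close>) since a convex cone absorbs itself: if \<open>z\<^sub>1\<close> and \<open>z\<^sub>2\<close>
  lie in the interior of \<open>C\<close>, then so does every element of \<open>co {z\<^sub>1, z\<^sub>2} + int C\<close>.  Quasi-concavity
  is joint in \<open>(s, t)\<close>, so convexity holds only for sets of pairs, and the strategy set of player
  \<open>i\<close> has to be \<open>X\<^sub>i \<times> X\<^sub>i\<close>.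

  The lower sections are open (\<open>openin_secure_replies\<close>).  Upper semicontinuity of
  \<open>p \<mapsto> Y - (- int C(p))\<close> together with regularity of topological vector spaces shows that a point
  of \<open>int C(p)\<close> has a neighbourhood contained in \<open>int C(p')\<close> for all \<open>p'\<close> near \<open>p\<close>.  With lower
  semicontinuity of \<open>f\<close>, the condition "\<open>f\<close> meets \<open>int C\<close>" is therefore open in \<open>(p, q, u)\<close>.
  Quantifying over \<open>u\<close> keeps it open because the closure of \<open>A\<close> has a closed graph and \<open>u\<close> ranges over
  a compact set.

  With open lower sections, a reply that is good at one profile stays good nearby.  So
  \<open>collective_fixed_point\<close> can blend finitely many constant selections by a partition of unity and
  apply Brouwer's theorem to the weights.  The number of weights is a bound variable there, so Brouwer's theorem is needed for
  simplices of arbitrary dimension inside one type.  It comes from the Hilbert cube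
  (\<open>hilbert_cube_fixed_point\<close>), where Kuhn's combinatorial lemma is applied in dimension \<open>n + 1\<close> for
  each \<open>n\<close> and compactness takes care of \<open>n \<rightarrow> \<infinity>\<close>.
\<close>

section \<open>Brouwer's theorem on the Hilbert cube and on simplices\<close>

definition hilbert_cube :: "(nat \<Rightarrow> real) set" where
  "hilbert_cube = {x. \<forall>i. x i \<in> {0..1}}"

lemma compact_hilbert_cube: "compact hilbert_cube"
proof -
  have "compactin (product_topology (\<lambda>i::nat. euclidean) UNIV) (\<Pi>\<^sub>E i\<in>UNIV. {0..1::real})"
    by (subst compactin_PiE) auto
  moreover have "hilbert_cube = (\<Pi>\<^sub>E i\<in>UNIV. {0..1::real})"
    by (auto simp: hilbert_cube_def PiE_def Pi_def)
  ultimately show ?thesis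
    by (simp add: euclidean_product_topology)
qed

lemma tendsto_coordinatewise_iff:
  fixes a :: "'b \<Rightarrow> 'i \<Rightarrow> 'a::topological_space"
  shows "(a \<longlongrightarrow> l) net \<longleftrightarrow> (\<forall>i. ((\<lambda>n. a n i) \<longlongrightarrow> l i) net)"
  using limitin_componentwise[of "\<lambda>i::'i. euclidean::'a topology" UNIV a l net]
  by (simp add: euclidean_product_topology)

text \<open>
  In dimension \<open>n + 1\<close>, divide the cube into cells of side \<open>1 / (n + 1)\<close> and label a grid point \<open>v\<close> in
  coordinate \<open>i\<close> by the sign of \<open>f v i - v i\<close>.  Kuhn's lemma gives a cell in which every coordinate
  changes its label.  As \<open>n\<close> grows, a subsequence of these cells shrinks to a point \<open>l\<close>.  In a fixed
  coordinate \<open>i\<close> there are points of both signs arbitrarily close to \<open>l\<close>, and so \<open>f l i = l i\<close>.  Since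
  only one coordinate is considered at a time, the growing dimension does no harm.
\<close>

theorem hilbert_cube_fixed_point:
  fixes f :: "(nat \<Rightarrow> real) \<Rightarrow> nat \<Rightarrow> real"
  assumes cont: "continuous_on hilbert_cube f" and self: "f \<in> hilbert_cube \<rightarrow> hilbert_cube"
  shows "\<exists>x\<in>hilbert_cube. f x = x"
proof -
  define pt :: "nat \<Rightarrow> (nat \<Rightarrow> nat) \<Rightarrow> nat \<Rightarrow> real" where
    "pt n v = (\<lambda>i. if i < Suc n then real (v i) / real (Suc n) else 0)" for n v
  have pt_cube: "pt n v \<in> hilbert_cube" if "\<forall>i<Suc n. v i \<le> Suc n" for n v
    using that by (auto simp: pt_def hilbert_cube_def divide_le_eq_1)
  have f01: "0 \<le> f x i \<and> f x i \<le> 1" if "x \<in> hilbert_cube" for x i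
    using self that by (auto simp: hilbert_cube_def Pi_iff)
  have cell: "\<exists>q. (\<forall>i<Suc n. q i < Suc n) \<and>
      (\<forall>i<Suc n. \<exists>r s. (\<forall>j<Suc n. q j \<le> r j \<and> r j \<le> q j + 1) \<and>
         (\<forall>j<Suc n. q j \<le> s j \<and> s j \<le> q j + 1) \<and>
         pt n r i \<le> f (pt n r) i \<and> f (pt n s) i \<le> pt n s i)" for n
  proof -
    \<comment> \<open>Grid values 0 and \<open>Suc n\<close> get the labels that Kuhn's lemma prescribes on the boundary; they agree
      with the sign of \<open>f v i - v i\<close> because \<open>f\<close> maps into the cube.\<close>
    define lab :: "(nat \<Rightarrow> nat) \<Rightarrow> nat \<Rightarrow> nat" where
      "lab v i = (if v i = 0 then 0 else if v i = Suc n then 1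
                  else if pt n v i \<le> f (pt n v) i then 0 else 1)" for v i
    obtain q where q: "\<forall>i<Suc n. q i < Suc n"
      and rs: "\<forall>i<Suc n. \<exists>r s. (\<forall>j<Suc n. q j \<le> r j \<and> r j \<le> q j + 1) \<and>
                 (\<forall>j<Suc n. q j \<le> s j \<and> s j \<le> q j + 1) \<and> lab r i \<noteq> lab s i"
      by (rule kuhn_lemma[of "Suc n" "Suc n" lab]) (auto simp: lab_def)
    have lab0: "pt n v i \<le> f (pt n v) i"
      if "lab v i = 0" "i < Suc n" "\<forall>i<Suc n. v i \<le> Suc n" for v i
      using that f01[OF pt_cube[OF that(3)], of i]
      by (auto simp: lab_def pt_def split: if_splits)
    have lab1: "f (pt n v) i \<le> pt n v i"
      if "lab v i \<noteq> 0" "i < Suc n" "\<forall>i<Suc n. v i \<le> Suc n" for v i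
      using that f01[OF pt_cube[OF that(3)], of i]
      by (auto simp: lab_def pt_def split: if_splits)
    have "\<exists>r s. (\<forall>j<Suc n. q j \<le> r j \<and> r j \<le> q j + 1) \<and>
         (\<forall>j<Suc n. q j \<le> s j \<and> s j \<le> q j + 1) \<and>
         pt n r i \<le> f (pt n r) i \<and> f (pt n s) i \<le> pt n s i" if i: "i < Suc n" for i
    proof -
      obtain r s where r: "\<forall>j<Suc n. q j \<le> r j \<and> r j \<le> q j + 1"
        and s: "\<forall>j<Suc n. q j \<le> s j \<and> s j \<le> q j + 1" and ne: "lab r i \<noteq> lab s i"
        using rs i by blast
      have rb: "\<forall>j<Suc n. r j \<le> Suc n" and sb: "\<forall>j<Suc n. s j \<le> Suc n"
        using q r s by (metis Suc_eq_plus1 Suc_leI le_trans)+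
      have "lab r i = 0 \<and> lab s i \<noteq> 0 \<or> lab s i = 0 \<and> lab r i \<noteq> 0"
        using ne by (auto simp: lab_def split: if_splits)
      then show ?thesis
        using r s lab0[OF _ i rb] lab0[OF _ i sb] lab1[OF _ i rb] lab1[OF _ i sb] by blast
    qed
    with q show ?thesis by blast
  qed
  then obtain q where q: "\<And>n i. i < Suc n \<Longrightarrow> q n i < Suc n"
    and qrs: "\<And>n i. i < Suc n \<Longrightarrow> \<exists>r s. (\<forall>j<Suc n. q n j \<le> r j \<and> r j \<le> q n j + 1) \<and>
         (\<forall>j<Suc n. q n j \<le> s j \<and> s j \<le> q n j + 1) \<and>
         pt n r i \<le> f (pt n r) i \<and> f (pt n s) i \<le> pt n s i"
    by metis
  define x where "x n = pt n (q n)" for n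
  have x_cube: "x n \<in> hilbert_cube" for n
    unfolding x_def by (rule pt_cube) (use q in \<open>simp add: less_imp_le\<close>)
  have "seq_compact hilbert_cube"
    by (simp add: compact_hilbert_cube compact_imp_seq_compact)
  then obtain l h where l: "l \<in> hilbert_cube" and h: "strict_mono h" and lim: "(x \<circ> h) \<longlonglongrightarrow> l"
    using x_cube unfolding seq_compact_def by metis
  \<comment> \<open>Coordinates \<open>j > n\<close> of grid points vanish, so the bound holds in all coordinates.\<close>
  have near: "pt n r \<in> hilbert_cube \<and> (\<forall>j. \<bar>pt n r j - x n j\<bar> \<le> inverse (real (Suc n)))"
    if "\<forall>j<Suc n. q n j \<le> r j \<and> r j \<le> q n j + 1" for n r
  proof
    have "\<forall>j<Suc n. r j \<le> Suc n"
      using that q by (metis Suc_eq_plus1 Suc_leI le_trans)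
    then show "pt n r \<in> hilbert_cube" by (rule pt_cube)
    show "\<forall>j. \<bar>pt n r j - x n j\<bar> \<le> inverse (real (Suc n))"
    proof
      fix j
      show "\<bar>pt n r j - x n j\<bar> \<le> inverse (real (Suc n))"
      proof (cases "j < Suc n")
        case True
        then have "\<bar>real (r j) - real (q n j)\<bar> \<le> 1" using that by force
        then have "\<bar>real (r j) - real (q n j)\<bar> / real (Suc n) \<le> 1 / real (Suc n)"
          by (intro divide_right_mono) auto
        with True show ?thesis
          by (simp add: pt_def x_def inverse_eq_divide flip: diff_divide_distrib)
      qed (simp add: pt_def x_def)
    qed
  qed
  have lim_near: "(\<lambda>n. f (a (h n)) i) \<longlonglongrightarrow> f l i \<and> (\<lambda>n. a (h n) i) \<longlonglongrightarrow> l i"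
    if a: "\<And>n. a n \<in> hilbert_cube" "\<And>n j. \<bar>a n j - x n j\<bar> \<le> inverse (real (Suc n))" for a i
  proof -
    have "(\<lambda>n. a (h n) j) \<longlonglongrightarrow> l j" for j
    proof -
      have "(\<lambda>n. a n j - x n j) \<longlonglongrightarrow> 0"
        by (rule Lim_null_comparison[OF _ LIMSEQ_inverse_real_of_nat])
           (use a(2) in \<open>auto simp: inverse_eq_divide\<close>)
      then have "(\<lambda>n. a (h n) j - x (h n) j) \<longlonglongrightarrow> 0"
        using LIMSEQ_subseq_LIMSEQ[OF _ h] by (fastforce simp: o_def)
      moreover have "(\<lambda>n. x (h n) j) \<longlonglongrightarrow> l j"
        using lim by (simp add: tendsto_coordinatewise_iff)
      ultimately show ?thesis
        using tendsto_add by fastforce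
    qed
    then have la: "(\<lambda>n. a (h n)) \<longlonglongrightarrow> l"
      by (simp add: tendsto_coordinatewise_iff)
    then have "(\<lambda>n. f (a (h n))) \<longlonglongrightarrow> f l"
      by (rule continuous_on_tendsto_compose[OF cont _ l]) (simp add: a(1))
    with la show ?thesis
      by (simp add: tendsto_coordinatewise_iff)
  qed
  have "f l i = l i" for i
  proof -
    have "\<exists>a b. (a \<in> hilbert_cube \<and> (\<forall>j. \<bar>a j - x n j\<bar> \<le> inverse (real (Suc n)))) \<and>
        (b \<in> hilbert_cube \<and> (\<forall>j. \<bar>b j - x n j\<bar> \<le> inverse (real (Suc n)))) \<and>
        (i \<le> n \<longrightarrow> a i \<le> f a i \<and> f b i \<le> b i)" for n
    \<comment> \<open>For \<open>n < i\<close> the cell says nothing about coordinate \<open>i\<close>; any nearby point serves as filler.\<close>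
    proof (cases "i \<le> n")
      case True
      then obtain r s where "\<forall>j<Suc n. q n j \<le> r j \<and> r j \<le> q n j + 1"
         "\<forall>j<Suc n. q n j \<le> s j \<and> s j \<le> q n j + 1"
         "pt n r i \<le> f (pt n r) i" "f (pt n s) i \<le> pt n s i"
        using qrs[of i n] by (auto simp: less_Suc_eq_le)
      then show ?thesis using near by blast
    next
      case False
      then show ?thesis using x_cube[of n] by (intro exI[of _ "x n"]) auto
    qed
    then obtain a b where ab: "\<And>n. a n \<in> hilbert_cube" "\<And>n. b n \<in> hilbert_cube"
        "\<And>n j. \<bar>a n j - x n j\<bar> \<le> inverse (real (Suc n))"
        "\<And>n j. \<bar>b n j - x n j\<bar> \<le> inverse (real (Suc n))"
        "\<And>n. i \<le> n \<Longrightarrow> a n i \<le> f (a n) i" "\<And>n. i \<le> n \<Longrightarrow> f (b n) i \<le> b n i"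
      by metis
    have late: "\<And>n. n \<ge> i \<Longrightarrow> i \<le> h n"
      using seq_suble[OF h] order_trans by blast
    have "l i \<le> f l i"
      by (rule LIMSEQ_le[of "\<lambda>n. a (h n) i" _ "\<lambda>n. f (a (h n)) i"])
         (use lim_near[of a i] ab late in \<open>auto intro!: exI[of _ i]\<close>)
    moreover have "f l i \<le> l i"
      by (rule LIMSEQ_le[of "\<lambda>n. f (b (h n)) i" _ "\<lambda>n. b (h n) i"])
         (use lim_near[of b i] ab late in \<open>auto intro!: exI[of _ i]\<close>)
    ultimately show ?thesis by simp
  qed
  with l show ?thesis by blast
qed

text \<open>
  The standard simplex with \<open>m\<close> vertices, with sequences padded by zeros so that \<open>m\<close> is a parameter
  and not part of the type.
\<close>

definition nat_simplex :: "nat \<Rightarrow> (nat \<Rightarrow> real) set" where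
  "nat_simplex m = {c. (\<forall>k. 0 \<le> c k) \<and> (\<forall>k\<ge>m. c k = 0) \<and> sum c {..<m} = 1}"

lemma nat_simplex_le_1:
  assumes "c \<in> nat_simplex m" shows "c k \<le> 1"
proof (cases "k < m")
  case True
  then have "c k \<le> sum c {..<m}"
    using assms by (intro member_le_sum) (auto simp: nat_simplex_def)
  then show ?thesis using assms by (simp add: nat_simplex_def)
qed (use assms in \<open>auto simp: nat_simplex_def\<close>)

text \<open>
  The simplex is a retract of the Hilbert cube, so the fixed point property passes to it.
\<close>

theorem simplex_fixed_point:
  fixes f :: "(nat \<Rightarrow> real) \<Rightarrow> nat \<Rightarrow> real"
  assumes "m > 0" and cont: "continuous_on (nat_simplex m) f"
    and self: "f \<in> nat_simplex m \<rightarrow> nat_simplex m"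
  shows "\<exists>c\<in>nat_simplex m. f c = c"
proof -
  define total where "total c = sum c {..<m}" for c :: "nat \<Rightarrow> real"
  \<comment> \<open>Missing mass \<open>1 - total c\<close> is spread evenly over the \<open>m\<close> vertices; excess mass is scaled down.\<close>
  define retr :: "(nat \<Rightarrow> real) \<Rightarrow> nat \<Rightarrow> real" where
    "retr c = (\<lambda>k. if k < m then (c k + max 0 (1 - total c) / m) / max 1 (total c) else 0)" for c
  have retr: "retr c \<in> nat_simplex m" if "c \<in> hilbert_cube" for c
  proof -
    have "sum (retr c) {..<m} = (total c + max 0 (1 - total c)) / max 1 (total c)"
      using \<open>m > 0\<close> by (simp add: retr_def sum.distrib total_def flip: sum_divide_distrib)
    also have "\<dots> = 1" by (simp add: max_def)
    finally have "sum (retr c) {..<m} = 1" .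
    then show ?thesis
      using that by (auto simp: nat_simplex_def hilbert_cube_def retr_def)
  qed
  have retr_id: "retr c = c" if "c \<in> nat_simplex m" for c
    using that by (auto simp: retr_def nat_simplex_def total_def)
  have sub: "nat_simplex m \<subseteq> hilbert_cube"
    using nat_simplex_le_1 by (auto simp: hilbert_cube_def) (auto simp: nat_simplex_def)
  have cont_coord: "continuous_on hilbert_cube (\<lambda>c. c k)" for k
    by (rule continuous_on_subset[OF continuous_on_product_coordinates]) simp
  have "continuous_on hilbert_cube (\<lambda>c. retr c k)" for k
    unfolding retr_def total_def
    by (cases "k < m") (auto intro!: continuous_intros cont_coord)
  then have "continuous_on hilbert_cube retr"
    by (rule continuous_on_coordinatewise_then_product)
  then have "continuous_on hilbert_cube (f \<circ> retr)"
    using retr by (intro continuous_on_compose) (auto intro: continuous_on_subset[OF cont])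
  moreover have "f \<circ> retr \<in> hilbert_cube \<rightarrow> hilbert_cube"
    using retr self sub by fastforce
  ultimately obtain c where c: "c \<in> hilbert_cube" "f (retr c) = c"
    using hilbert_cube_fixed_point[of "f \<circ> retr"] by auto
  then have "c \<in> nat_simplex m" using retr[of c] self by (metis PiE)
  with c retr_id show ?thesis by metis
qed

section \<open>Topological vector spaces and convex cones\<close>

lemma tvs_subspace: "tvs_topology T \<Longrightarrow> subspace (topspace T)"
  by (simp add: tvs_topology_def)

lemma continuous_map_tvs_add:
  assumes "tvs_topology T" "continuous_map S T f" "continuous_map S T g"
  shows "continuous_map S T (\<lambda>x. f x + g x)"
  using continuous_map_compose[OF continuous_map_pairedI[OF assms(2,3)], of T "\<lambda>(x, y). x + y"]
    assms(1) by (simp add: tvs_topology_def o_def)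

lemma continuous_map_tvs_scale:
  assumes "tvs_topology T" "continuous_map S euclideanreal f" "continuous_map S T g"
  shows "continuous_map S T (\<lambda>x. f x *\<^sub>R g x)"
  using continuous_map_compose[OF continuous_map_pairedI[OF assms(2,3)], of T "\<lambda>(c, x). c *\<^sub>R x"]
    assms(1) by (simp add: tvs_topology_def o_def)

lemma continuous_map_tvs_minus:
  assumes "tvs_topology T" "continuous_map S T f"
  shows "continuous_map S T (\<lambda>x. - f x)"
  using continuous_map_tvs_scale[OF assms(1) _ assms(2), of "\<lambda>_. -1"] by simp

lemma continuous_map_tvs_diff:
  assumes "tvs_topology T" "continuous_map S T f" "continuous_map S T g"
  shows "continuous_map S T (\<lambda>x. f x - g x)"
  using continuous_map_tvs_add[OF assms(1,2) continuous_map_tvs_minus[OF assms(1,3)]] by simp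

lemma continuous_map_tvs_sum:
  assumes T: "tvs_topology T" and "finite J" "\<And>k. k \<in> J \<Longrightarrow> continuous_map S T (f k)"
  shows "continuous_map S T (\<lambda>x. \<Sum>k\<in>J. f k x)"
  using assms(2,3)
proof (induction J)
  case empty
  then show ?case using T by (simp add: tvs_subspace subspace_0)
next
  case (insert k J)
  then show ?case by (simp add: continuous_map_tvs_add[OF T])
qed

lemma openin_tvs_minus:
  assumes "tvs_topology T" "openin T U"
  shows "openin T (uminus ` U)"
proof -
  have "openin T {x \<in> topspace T. - x \<in> U}"
    using continuous_map_tvs_minus[OF assms(1) continuous_map_id[of T]] assms(2)
    by (auto simp: continuous_map_def id_def)
  moreover have "{x \<in> topspace T. - x \<in> U} = uminus ` U"
    using openin_subset[OF assms(2)] subspace_neg[OF tvs_subspace[OF assms(1)]] 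
    by (auto simp: image_iff) force
  ultimately show ?thesis by simp
qed

lemma openin_tvs_translation:
  assumes T: "tvs_topology T" and "openin T U" "a \<in> topspace T"
  shows "openin T ((+) a ` U)"
proof -
  have "openin T {x \<in> topspace T. x - a \<in> U}"
    using continuous_map_tvs_diff[OF T continuous_map_id[of T], of "\<lambda>_. a"] assms(2,3)
    by (auto simp: continuous_map_def id_def)
  moreover have "{x \<in> topspace T. x - a \<in> U} = (+) a ` U"
    using openin_subset[OF assms(2)] subspace_add[OF tvs_subspace[OF T] assms(3)]
    by (auto simp: image_iff) force
  ultimately show ?thesis by simp
qed

text \<open>
  If \<open>z\<close> lies in the open complement of \<open>S\<close>, then by continuity so does \<open>z + N - M\<close> for suitable
  neighbourhoods \<open>N\<close> and \<open>M\<close> of zero; then \<open>z + N\<close> and \<open>S + M\<close> are disjoint.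
\<close>

lemma tvs_regular_space:
  assumes T: "tvs_topology T"
  shows "regular_space T"
  unfolding regular_space_def
proof (intro allI impI, elim conjE)
  fix S z
  assume S: "closedin T S" and z: "z \<in> topspace T - S"
  note sub = tvs_subspace[OF T]
  let ?h = "\<lambda>(a, b). z + a - b"
  have h: "continuous_map (prod_topology T T) T ?h"
    using z unfolding split_beta
    by (intro continuous_map_tvs_diff[OF T] continuous_map_tvs_add[OF T]
        continuous_map_fst continuous_map_snd) auto
  have "openin (prod_topology T T) {ab \<in> topspace (prod_topology T T). ?h ab \<in> topspace T - S}"
    using h S by (intro openin_continuous_map_preimage) auto
  moreover have "(0, 0) \<in> {ab \<in> topspace (prod_topology T T). ?h ab \<in> topspace T - S}"
    using z subspace_0[OF sub] by simp
  ultimately obtain N M where N: "openin T N" "0 \<in> N" and M: "openin T M" "0 \<in> M"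
    and NM: "N \<times> M \<subseteq> {ab \<in> topspace (prod_topology T T). ?h ab \<in> topspace T - S}"
    unfolding openin_prod_topology_alt by (elim allE[of _ 0] impE exE conjE) (assumption, rule that)
  have "openin T ((+) z ` N)" using openin_tvs_translation[OF T N(1)] z by simp
  moreover have "openin T (\<Union>s\<in>S. (+) s ` M)"
    using closedin_subset[OF S] by (intro openin_Union) (auto intro!: openin_tvs_translation[OF T M(1)])
  moreover have "z \<in> (+) z ` N" using N(2) by force
  moreover have "S \<subseteq> (\<Union>s\<in>S. (+) s ` M)" using M(2) by force
  moreover have "disjnt ((+) z ` N) (\<Union>s\<in>S. (+) s ` M)"
    unfolding disjnt_iff
  proof clarify
    fix a s b
    assume "a \<in> N" "s \<in> S" "b \<in> M" "z + a = s + b"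
    then show False using NM[THEN subsetD, of "(a, b)"] by (simp add: algebra_simps)
  qed
  ultimately show "\<exists>U V. openin T U \<and> openin T V \<and> z \<in> U \<and> S \<subseteq> V \<and> disjnt U V"
    by blast
qed

text \<open>
  The players of the fixed point theorem choose pairs, so their strategies live in product spaces.
\<close>

lemma tvs_topology_prod:
  assumes S: "tvs_topology S" and T: "tvs_topology T"
  shows "tvs_topology (prod_topology S T)"
proof -
  let ?P = "prod_topology S T"
  have proj: "continuous_map U S (\<lambda>w. fst (h w))" "continuous_map U T (\<lambda>w. snd (h w))"
    if "continuous_map U ?P h" for U :: "'u topology" and h
    using continuous_map_fst_of[OF that] continuous_map_snd_of[OF that] by (simp_all add: o_def)
  have "subspace (topspace ?P)"
    using tvs_subspace[OF S] tvs_subspace[OF T] by (simp add: subspace_Times)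
  moreover have "continuous_map (prod_topology ?P ?P) ?P (\<lambda>(x, y). x + y)"
  proof -
    have "continuous_map (prod_topology ?P ?P) ?P
        (\<lambda>w. (fst (fst w) + fst (snd w), snd (fst w) + snd (snd w)))"
      by (intro continuous_map_pairedI continuous_map_tvs_add[OF S] continuous_map_tvs_add[OF T])
         (intro proj[OF continuous_map_fst] proj[OF continuous_map_snd] continuous_map_fst)+
    then show ?thesis by (simp add: case_prod_unfold plus_prod_def)
  qed
  moreover have "continuous_map (prod_topology euclideanreal ?P) ?P (\<lambda>(c, x). c *\<^sub>R x)"
  proof -
    have "continuous_map (prod_topology euclideanreal ?P) ?P
        (\<lambda>w. (fst w *\<^sub>R fst (snd w), fst w *\<^sub>R snd (snd w)))"
      by (intro continuous_map_pairedI continuous_map_tvs_scale[OF S] continuous_map_tvs_scale[OF T])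
         (intro proj[OF continuous_map_fst] proj[OF continuous_map_snd] continuous_map_fst)+
    then show ?thesis by (simp add: case_prod_unfold scaleR_prod_def)
  qed
  ultimately show ?thesis by (simp add: tvs_topology_def)
qed

text \<open>
  The translate of the interior by \<open>c\<close> is open and stays inside the convex cone.
\<close>

lemma cone_interior_add:
  assumes T: "tvs_topology T" and "convex C" "cone C" and c: "c \<in> C \<inter> topspace T"
    and d: "d \<in> T interior_of C"
  shows "c + d \<in> T interior_of C"
proof -
  have add: "\<forall>x\<in>C. \<forall>y\<in>C. x + y \<in> C"
    using convex_cone[of C] assms(2,3) by blast
  have "openin T ((+) c ` (T interior_of C))"
    using openin_tvs_translation[OF T] c by simp
  moreover have "(+) c ` (T interior_of C) \<subseteq> C"
    using add c interior_of_subset[of T C] by blast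
  ultimately have "(+) c ` (T interior_of C) \<subseteq> T interior_of C"
    by (simp add: interior_of_maximal)
  with d show ?thesis by blast
qed

section \<open>A fixed point theorem for correspondences with open lower sections\<close>

text \<open>
  Every point \<open>w\<close> comes with its own neighbourhood \<open>U w\<close>, and the index set \<open>D\<close> consists of finitely
  many of these points.  Complete regularity gives a function that is positive at \<open>w\<close> and vanishes
  off \<open>U w\<close>; finitely many of the sets where these functions are positive cover the space, and
  dividing by the sum normalises them.
\<close>

lemma partition_of_unity:
  assumes K: "compact_space K" "Hausdorff_space K"
    and U: "\<And>w. w \<in> topspace K \<Longrightarrow> openin K (U w) \<and> w \<in> U w"
  obtains D and \<beta> :: "'a \<Rightarrow> 'a \<Rightarrow> real"
  where "finite D" "D \<subseteq> topspace K"
    and "\<And>d. d \<in> D \<Longrightarrow> continuous_map K euclideanreal (\<beta> d)"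
    and "\<And>d w. \<lbrakk>d \<in> D; w \<in> topspace K\<rbrakk> \<Longrightarrow> 0 \<le> \<beta> d w"
    and "\<And>w. w \<in> topspace K \<Longrightarrow> (\<Sum>d\<in>D. \<beta> d w) = 1"
    and "\<And>d w. \<lbrakk>d \<in> D; w \<in> topspace K; \<beta> d w \<noteq> 0\<rbrakk> \<Longrightarrow> w \<in> U d"
proof -
  have reg: "completely_regular_space K"
    using K by (simp add: compact_Hausdorff_or_regular_imp_normal_space
        normal_imp_completely_regular_space)
  have "\<exists>g. continuous_map K euclideanreal g \<and> (\<forall>v\<in>topspace K. 0 \<le> g v) \<and> 0 < g w \<and>
      (\<forall>v\<in>topspace K - U w. g v = (0::real))" if w: "w \<in> topspace K" for w
  proof -
    have "closedin K (topspace K - U w)" "w \<in> topspace K - (topspace K - U w)"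
      using U[OF w] w by auto
    then obtain h :: "'a \<Rightarrow> real" where h: "continuous_map K (top_of_set {0..1}) h" "h w = 0"
      "h ` (topspace K - U w) \<subseteq> {1}"
      using reg unfolding completely_regular_space_def by meson
    then have "continuous_map K euclideanreal h" "\<forall>v\<in>topspace K. h v \<le> 1"
      by (auto simp: continuous_map_in_subtopology Pi_iff)
    with h show ?thesis
      by (intro exI[of _ "\<lambda>v. 1 - h v"]) (auto intro!: continuous_intros)
  qed
  then have "\<forall>w\<in>topspace K. \<exists>g. continuous_map K euclideanreal g \<and>
      (\<forall>v\<in>topspace K. 0 \<le> g v) \<and> 0 < g w \<and> (\<forall>v\<in>topspace K - U w. g v = (0::real))"
    by blast
  from bchoice[OF this] obtain g :: "'a \<Rightarrow> 'a \<Rightarrow> real" where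
    gc: "\<And>w. w \<in> topspace K \<Longrightarrow> continuous_map K euclideanreal (g w)"
    and g0: "\<And>w v. \<lbrakk>w \<in> topspace K; v \<in> topspace K\<rbrakk> \<Longrightarrow> 0 \<le> g w v"
    and gpos: "\<And>w. w \<in> topspace K \<Longrightarrow> 0 < g w w"
    and gU: "\<And>w v. \<lbrakk>w \<in> topspace K; v \<in> topspace K; v \<notin> U w\<rbrakk> \<Longrightarrow> g w v = 0"
    by blast
  define V where "V w = {v \<in> topspace K. g w v \<in> {0<..}}" for w
  have "\<And>w. w \<in> topspace K \<Longrightarrow> openin K (V w)"
    unfolding V_def by (rule openin_continuous_map_preimage[OF gc]) auto
  moreover have "topspace K \<subseteq> \<Union>(V ` topspace K)"
    using gpos by (auto simp: V_def)
  ultimately obtain \<F> where "finite \<F>" "\<F> \<subseteq> V ` topspace K" "topspace K \<subseteq> \<Union>\<F>"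
    using K(1) unfolding compact_space_alt by (metis (no_types, lifting) imageE)
  then obtain D where D: "finite D" "D \<subseteq> topspace K" "topspace K \<subseteq> \<Union>(V ` D)"
    by (metis finite_subset_image)
  have pos: "0 < (\<Sum>d\<in>D. g d w)" if w: "w \<in> topspace K" for w
  proof -
    obtain d where "d \<in> D" "0 < g d w" using D(3) w by (auto simp: V_def)
    then show ?thesis
      using D w by (intro sum_pos2[of D d]) (auto intro!: g0)
  qed
  show thesis
  proof (rule that[of D "\<lambda>d w. g d w / (\<Sum>d\<in>D. g d w)"])
    show "continuous_map K euclideanreal (\<lambda>w. g d w / (\<Sum>d\<in>D. g d w))" if "d \<in> D" for d
      using that D pos by (intro continuous_map_real_divide continuous_map_sum) (auto intro!: gc simp: less_imp_neq[symmetric])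
    show "0 \<le> g d w / (\<Sum>d\<in>D. g d w)" if "d \<in> D" "w \<in> topspace K" for d w
      using that D pos[OF that(2)] g0 by (intro divide_nonneg_pos) auto
    show "(\<Sum>d\<in>D. g d w / (\<Sum>d\<in>D. g d w)) = 1" if "w \<in> topspace K" for w
      using pos[OF that] by (simp flip: sum_divide_distrib)
    show "w \<in> U d" if "d \<in> D" "w \<in> topspace K" "g d w / (\<Sum>d\<in>D. g d w) \<noteq> 0" for d w
      using that D gU[of d w] by auto
  qed (use D in auto)
qed

text \<open>
  Choose for every profile \<open>d\<close> a selection \<open>z d\<close> with \<open>z d i \<in> G i d\<close>.  Open lower sections make
  the same \<open>z d\<close> valid for all profiles in a neighbourhood \<open>U d\<close>.  A partition of unity \<open>\<beta>\<close>
  subordinate to these neighbourhoods turns a profile into a vector of weights, and weights turn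
  into a profile by forming the convex combination \<open>\<sigma>\<close> of the finitely many selections.
  Brouwer's theorem provides weights \<open>c\<close> that return to themselves.  For \<open>w = \<sigma> c\<close> each selection
  of positive weight is valid at \<open>w\<close>, and \<open>w i\<close> lies in \<open>G i w\<close> by convexity.
\<close>

theorem collective_fixed_point:
  fixes I :: "'i set" and T :: "'i \<Rightarrow> 'a::real_vector topology" and Z :: "'i \<Rightarrow> 'a set"
    and G :: "'i \<Rightarrow> ('i \<Rightarrow> 'a) \<Rightarrow> 'a set"
  defines "K \<equiv> product_topology (\<lambda>i. subtopology (T i) (Z i)) I"
  assumes I: "finite I"
    and T: "\<And>i. i \<in> I \<Longrightarrow> tvs_topology (T i) \<and> Hausdorff_space (T i)"
    and Z: "\<And>i. i \<in> I \<Longrightarrow> Z i \<noteq> {} \<and> convex (Z i) \<and> compactin (T i) (Z i)"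
    and G: "\<And>i w. \<lbrakk>i \<in> I; w \<in> Pi\<^sub>E I Z\<rbrakk> \<Longrightarrow> G i w \<noteq> {} \<and> G i w \<subseteq> Z i \<and> convex (G i w)"
    and G_open: "\<And>i z. \<lbrakk>i \<in> I; z \<in> Z i\<rbrakk> \<Longrightarrow> openin K {w \<in> Pi\<^sub>E I Z. z \<in> G i w}"
  shows "\<exists>w\<in>Pi\<^sub>E I Z. \<forall>i\<in>I. w i \<in> G i w"
proof -
  have top: "topspace (subtopology (T i) (Z i)) = Z i" if "i \<in> I" for i
    using Z[OF that] compactin_subset_topspace by fastforce
  then have topK: "topspace K = Pi\<^sub>E I Z"
    by (auto simp: K_def intro!: PiE_cong)
  have compK: "compact_space K"
    unfolding K_def using Z by (auto simp: compact_space_product_topology compact_space_subtopology)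
  have HausK: "Hausdorff_space K"
    unfolding K_def using T by (auto simp: Hausdorff_space_product_topology Hausdorff_space_subtopology)
  have "\<exists>z\<in>Pi\<^sub>E I Z. \<forall>i\<in>I. z i \<in> G i w" if "w \<in> Pi\<^sub>E I Z" for w
  proof
    let ?z = "\<lambda>i\<in>I. SOME t. t \<in> G i w"
    show z: "\<forall>i\<in>I. ?z i \<in> G i w" using G[OF _ that] by (simp add: some_in_eq)
    show "?z \<in> Pi\<^sub>E I Z" using z G[OF _ that] by (intro PiE_I) fastforce+
  qed
  then obtain z where zK: "\<And>w. w \<in> Pi\<^sub>E I Z \<Longrightarrow> z w \<in> Pi\<^sub>E I Z"
    and zG: "\<And>w i. \<lbrakk>w \<in> Pi\<^sub>E I Z; i \<in> I\<rbrakk> \<Longrightarrow> z w i \<in> G i w"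
    by metis
  \<comment> \<open>Intersecting with the whole space matters only for empty \<open>I\<close>.\<close>
  define U where "U d = (\<Inter>i\<in>I. {w \<in> Pi\<^sub>E I Z. z d i \<in> G i w}) \<inter> topspace K" for d
  have "openin K (U d) \<and> d \<in> U d" if "d \<in> topspace K" for d
  proof
    show "openin K (U d)"
      unfolding U_def
      by (rule openin_INT[OF I]) (use that zK topK in \<open>auto intro!: G_open\<close>)
  qed (use that zG topK in \<open>auto simp: U_def\<close>)
  then obtain D \<beta> where D: "finite D" "D \<subseteq> topspace K"
    and \<beta>_cont: "\<And>d. d \<in> D \<Longrightarrow> continuous_map K euclideanreal (\<beta> d)"
    and \<beta>_nonneg: "\<And>d w. \<lbrakk>d \<in> D; w \<in> topspace K\<rbrakk> \<Longrightarrow> 0 \<le> \<beta> d w"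
    and \<beta>_sum: "\<And>w. w \<in> topspace K \<Longrightarrow> (\<Sum>d\<in>D. \<beta> d w) = 1"
    and \<beta>_supp: "\<And>d w. \<lbrakk>d \<in> D; w \<in> topspace K; \<beta> d w \<noteq> 0\<rbrakk> \<Longrightarrow> w \<in> U d"
    using partition_of_unity[OF compK HausK, of U] by metis
  define m where "m = card D"
  obtain d where d: "bij_betw d {..<m} D"
    using ex_bij_betw_nat_finite[OF D(1)] by (auto simp: m_def atLeast0LessThan)
  then have dD: "d k \<in> D" if "k < m" for k using that by (auto dest: bij_betwE)
  then have "d k \<in> Pi\<^sub>E I Z" if "k < m" for k using that D(2) topK by blast
  then have zZ: "z (d k) i \<in> Z i" if "k < m" "i \<in> I" for k i
    using PiE_mem[OF zK] that by blast
  have "Pi\<^sub>E I Z \<noteq> {}" using Z by (simp add: PiE_eq_empty_iff)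
  then have "D \<noteq> {}" using \<beta>_sum topK by fastforce
  then have "m > 0" using D(1) by (simp add: m_def card_gt_0_iff)
  \<comment> \<open>The selections are fixed and only the scalars vary, so \<open>\<sigma>\<close> is continuous in any vector topology.\<close>
  define \<sigma> where "\<sigma> c = (\<lambda>i\<in>I. \<Sum>k<m. c k *\<^sub>R z (d k) i)" for c
  have \<sigma>_Z: "\<sigma> c i \<in> Z i" if "c \<in> nat_simplex m" "i \<in> I" for c i
    using that zZ Z by (auto simp: \<sigma>_def nat_simplex_def intro!: convex_sum)
  then have \<sigma>_K: "\<sigma> c \<in> topspace K" if "c \<in> nat_simplex m" for c
    using that by (auto simp: topK \<sigma>_def)
  have \<sigma>_cont: "continuous_map (top_of_set (nat_simplex m)) K \<sigma>"
    unfolding K_def continuous_map_componentwise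
  proof (intro conjI ballI)
    fix i assume i: "i \<in> I"
    have "continuous_map (top_of_set (nat_simplex m)) (T i) (\<lambda>c. \<Sum>k<m. c k *\<^sub>R z (d k) i)"
      using T[OF i] zZ i Z[OF i] compactin_subset_topspace[of "T i" "Z i"]
      by (intro continuous_map_tvs_sum continuous_map_tvs_scale)
         (auto intro!: continuous_on_subset[OF continuous_on_product_coordinates])
    then show "continuous_map (top_of_set (nat_simplex m)) (subtopology (T i) (Z i)) (\<lambda>c. \<sigma> c i)"
      using \<sigma>_Z i by (auto simp: continuous_map_in_subtopology) (auto simp: \<sigma>_def)
  qed (auto simp: \<sigma>_def)
  define h where "h c = (\<lambda>k. if k < m then \<beta> (d k) (\<sigma> c) else 0)" for c
  have "continuous_on (nat_simplex m) (\<lambda>c. h c k)" for k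
    using continuous_map_compose[OF \<sigma>_cont \<beta>_cont[OF dD]]
    by (cases "k < m") (simp_all add: h_def o_def)
  then have "continuous_on (nat_simplex m) h"
    by (rule continuous_on_coordinatewise_then_product)
  moreover have "h \<in> nat_simplex m \<rightarrow> nat_simplex m"
  proof
    fix c assume c: "c \<in> nat_simplex m"
    have "(\<Sum>k<m. h c k) = (\<Sum>k<m. \<beta> (d k) (\<sigma> c))" by (simp add: h_def)
    also have "\<dots> = 1" using sum.reindex_bij_betw[OF d, of "\<lambda>e. \<beta> e (\<sigma> c)"] \<beta>_sum[OF \<sigma>_K[OF c]] by simp
    finally show "h c \<in> nat_simplex m"
      using \<beta>_nonneg[OF dD \<sigma>_K[OF c]] by (auto simp: nat_simplex_def h_def)
  qed
  ultimately obtain c where c: "c \<in> nat_simplex m" and fp: "h c = c"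
    using simplex_fixed_point[OF \<open>m > 0\<close>] by blast
  have "\<sigma> c i \<in> G i (\<sigma> c)" if i: "i \<in> I" for i
  proof -
    have "z (d k) i \<in> G i (\<sigma> c)" if "k < m" "c k \<noteq> 0" for k
    proof -
      have "\<beta> (d k) (\<sigma> c) = c k" using fun_cong[OF fp, of k] that by (simp add: h_def)
      then have "\<sigma> c \<in> U (d k)" using \<beta>_supp[OF dD \<sigma>_K[OF c]] that by simp
      then show ?thesis using i by (simp add: U_def)
    qed
    moreover have "(\<Sum>k\<in>{k\<in>{..<m}. c k \<noteq> 0}. c k) = 1"
      using c by (subst sum.mono_neutral_left[of "{..<m}"]) (auto simp: nat_simplex_def)
    ultimately have "(\<Sum>k\<in>{k\<in>{..<m}. c k \<noteq> 0}. c k *\<^sub>R z (d k) i) \<in> G i (\<sigma> c)"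
      using G[OF i, of "\<sigma> c"] \<sigma>_K[OF c] topK c by (intro convex_sum) (auto simp: nat_simplex_def)
    also have "(\<Sum>k\<in>{k\<in>{..<m}. c k \<noteq> 0}. c k *\<^sub>R z (d k) i) = \<sigma> c i"
      using i by (auto simp: \<sigma>_def intro!: sum.mono_neutral_left)
    finally show ?thesis .
  qed
  with \<sigma>_K[OF c] topK show ?thesis by blast
qed

section \<open>Replies that are secure against the closure of the constraint\<close>

text \<open>
  A point \<open>z\<close> of \<open>int C(p)\<close> gives \<open>- z\<close> outside the closed set \<open>Y - (- int C(p))\<close>.  Separate the two
  by regularity.  Upper semicontinuity keeps the closed set inside its neighbourhood when \<open>p\<close>
  moves, so a fixed neighbourhood of \<open>z\<close> stays inside \<open>int C\<close>; lower semicontinuity keeps the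
  values of \<open>\<Phi>\<close> meeting that neighbourhood.
\<close>

lemma openin_meets_interior:
  assumes Y: "tvs_topology Y" and \<Phi>: "lower_semicontinuous Q Y \<Phi>"
    and C: "upper_semicontinuous P Y (\<lambda>p. topspace Y - uminus ` (Y interior_of C p))"
    and \<pi>: "continuous_map Q P \<pi>"
  shows "openin Q {w \<in> topspace Q. \<Phi> w \<inter> Y interior_of C (\<pi> w) \<noteq> {}}"
proof (subst openin_subopen, rule ballI)
  fix w assume "w \<in> {w \<in> topspace Q. \<Phi> w \<inter> Y interior_of C (\<pi> w) \<noteq> {}}"
  then obtain z where w: "w \<in> topspace Q" and z: "z \<in> \<Phi> w" "z \<in> Y interior_of C (\<pi> w)"
    by blast
  let ?W = "\<lambda>p. topspace Y - uminus ` (Y interior_of C p)"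
  have int_top: "Y interior_of C p \<subseteq> topspace Y" for p
    by (rule interior_of_subset_topspace)
  have "closedin Y (?W (\<pi> w))"
    by (intro closedin_diff closedin_topspace openin_tvs_minus[OF Y] openin_interior_of)
  moreover have "- z \<in> topspace Y - ?W (\<pi> w)"
    using z(2) int_top subspace_neg[OF tvs_subspace[OF Y], of z] by auto
  ultimately obtain U V where U: "openin Y U" "- z \<in> U" and V: "openin Y V" "?W (\<pi> w) \<subseteq> V"
    and UV: "disjnt U V"
    using tvs_regular_space[OF Y] unfolding regular_space_def by meson
  have "\<pi> w \<in> topspace P" using \<pi> w by (auto simp: continuous_map_def)
  then obtain P' where P': "openin P P'" "\<pi> w \<in> P'" "\<forall>p\<in>P'. ?W p \<subseteq> V"
    using C[unfolded upper_semicontinuous_def, rule_format, OF _ conjI[OF V]] by metis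
  have U_int: "uminus ` U \<subseteq> Y interior_of C p" if "p \<in> P'" for p
  proof clarify
    fix v assume "v \<in> U"
    then have "v \<in> topspace Y" "v \<notin> V"
      using openin_subset[OF U(1)] UV by (auto simp: disjnt_iff)
    moreover have "?W p \<subseteq> V" using P'(3) that by blast
    ultimately have "v \<in> uminus ` (Y interior_of C p)" by blast
    then show "- v \<in> Y interior_of C p" by auto
  qed
  have "z \<in> uminus ` U" using imageI[OF U(2), of uminus] by simp
  then obtain Q' where Q': "openin Q Q'" "w \<in> Q'" "\<forall>w'\<in>Q'. \<Phi> w' \<inter> uminus ` U \<noteq> {}"
    using \<Phi>[unfolded lower_semicontinuous_def, rule_format, OF w conjI[OF openin_tvs_minus[OF Y U(1)]]] z(1)
    by blast
  have "openin Q (Q' \<inter> {w \<in> topspace Q. \<pi> w \<in> P'})"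
    by (intro openin_Int Q'(1) openin_continuous_map_preimage[OF \<pi> P'(1)])
  moreover have "w \<in> Q' \<inter> {w \<in> topspace Q. \<pi> w \<in> P'}" using Q' w P' by blast
  moreover have "Q' \<inter> {w \<in> topspace Q. \<pi> w \<in> P'}
      \<subseteq> {w \<in> topspace Q. \<Phi> w \<inter> Y interior_of C (\<pi> w) \<noteq> {}}"
    using U_int Q'(3) by blast
  ultimately show "\<exists>O'. openin Q O' \<and> w \<in> O' \<and>
      O' \<subseteq> {w \<in> topspace Q. \<Phi> w \<inter> Y interior_of C (\<pi> w) \<noteq> {}}"
    by blast
qed

text \<open>
  Quasi-concavity yields \<open>z = c + d\<close> with \<open>c\<close> a convex combination of two points of the cone and
  \<open>d\<close> in its interior, and such sums are interior points.
\<close>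

lemma convex_meets_interior:
  assumes Y: "tvs_topology Y" and C: "convex C" "cone C" "C \<subseteq> topspace Y"
    and K: "convex K" and \<Phi>: "natural_quasi_concave K (Y interior_of C) \<Phi>"
  shows "convex {k \<in> K. \<Phi> k \<inter> Y interior_of C \<noteq> {}}"
proof (rule convexI)
  fix k1 k2 and a b :: real
  assume k: "k1 \<in> {k \<in> K. \<Phi> k \<inter> Y interior_of C \<noteq> {}}" "k2 \<in> {k \<in> K. \<Phi> k \<inter> Y interior_of C \<noteq> {}}"
    and ab: "0 \<le> a" "0 \<le> b" "a + b = 1"
  then obtain z1 z2 where z: "z1 \<in> \<Phi> k1" "z1 \<in> Y interior_of C" "z2 \<in> \<Phi> k2" "z2 \<in> Y interior_of C"
    by blast
  have b: "b = 1 - a" and "a \<in> {0..1}" using ab by auto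
  then obtain c d where cd: "c + d \<in> \<Phi> (a *\<^sub>R k1 + b *\<^sub>R k2)" "c \<in> convex hull {z1, z2}"
      "d \<in> Y interior_of C"
    using \<Phi>[unfolded natural_quasi_concave_def, rule_format, of k1 k2 a z1 z2] k z by blast
  have "convex hull {z1, z2} \<subseteq> C"
    using z interior_of_subset[of Y C] C(1) by (intro hull_minimal) auto
  then have "c + d \<in> Y interior_of C"
    using cone_interior_add[OF Y C(1,2)] cd C(3) by blast
  moreover have "a *\<^sub>R k1 + b *\<^sub>R k2 \<in> K"
    using k ab K by (auto intro: convexD)
  ultimately show "a *\<^sub>R k1 + b *\<^sub>R k2 \<in> {k \<in> K. \<Phi> k \<inter> Y interior_of C \<noteq> {}}"
    using cd(1) by blast
qed

text \<open>
  The tube lemma in projected form: the points where the inclusion fails are the projection of the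
  closed set \<open>S - W\<close> along a compact factor.
\<close>

lemma openin_fibre_subset:
  assumes V: "compact_space V" and S: "closedin (prod_topology Q V) S"
    and W: "openin (prod_topology Q V) W"
  shows "openin Q {w \<in> topspace Q. \<forall>u. (w, u) \<in> S \<longrightarrow> (w, u) \<in> W}"
proof -
  have "closedin Q (fst ` (S - W))"
    using closed_map_fst[OF V, of Q] closedin_diff[OF S W] by (auto simp: closed_map_def)
  then have "openin Q (topspace Q - fst ` (S - W))" by blast
  moreover have "topspace Q - fst ` (S - W) = {w \<in> topspace Q. \<forall>u. (w, u) \<in> S \<longrightarrow> (w, u) \<in> W}"
    by force
  ultimately show ?thesis by simp
qed

lemma subset_graph_closure:
  assumes "p \<in> topspace P" "correspondence (topspace P) (topspace V) A"
  shows "A p \<subseteq> graph_closure P V A p"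
proof
  fix u assume u: "u \<in> A p"
  have "(SIGMA p : topspace P. A p) \<subseteq> topspace (prod_topology P V)"
    using assms(2) by (auto simp: correspondence_def)
  then have "(SIGMA p : topspace P. A p) \<subseteq> prod_topology P V closure_of (SIGMA p : topspace P. A p)"
    by (rule closure_of_subset)
  then show "u \<in> graph_closure P V A p"
    using u assms by (auto simp: graph_closure_def correspondence_def)
qed

text \<open>
  One player's problem in isolation: \<open>p\<close> and \<open>q\<close> are the strategies of the others in the first and
  in the second profile, and \<open>\<phi> p s q t u\<close> is \<open>f\<^sub>i(p, s, q, t, u)\<close>.  The constraint ranges over the
  closure of \<open>A\<close>, because the open lower section property needs a closed graph.
\<close>

definition secure_replies ::
    "'p topology \<Rightarrow> 'e topology \<Rightarrow> 'y topology \<Rightarrow> ('p \<Rightarrow> 'e set) \<Rightarrow> ('p \<Rightarrow> 'e set) \<Rightarrow> ('p \<Rightarrow> 'y set) \<Rightarrow>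
      ('p \<Rightarrow> 'e \<Rightarrow> 'p \<Rightarrow> 'e \<Rightarrow> 'e \<Rightarrow> 'y set) \<Rightarrow> 'p \<Rightarrow> 'p \<Rightarrow> ('e \<times> 'e) set" where
  "secure_replies P V Y A F C \<phi> p q =
     {(s, t). s \<in> A p \<and> t \<in> F q \<and>
        (\<forall>u\<in>graph_closure P V A p. \<phi> p s q t u \<inter> Y interior_of C p \<noteq> {})}"

text \<open>
  The section is cut out by three open conditions: one from \<open>A\<close>, one from \<open>F\<close>, and the inclusion
  of the fibres of the closed graph \<open>S\<close> in those of the open set on which \<open>\<phi>\<close> meets the interior.
\<close>

lemma openin_secure_replies:
  assumes Y: "tvs_topology Y" and V: "compact_space V"
    and A: "open_lower_sections P V A" and F: "open_lower_sections P V F"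
    and C: "upper_semicontinuous P Y (\<lambda>p. topspace Y - uminus ` (Y interior_of C p))"
    and st: "s \<in> topspace V" "t \<in> topspace V"
    and \<phi>: "lower_semicontinuous (prod_topology P (prod_topology P V)) Y (\<lambda>(p, q, u). \<phi> p s q t u)"
  shows "openin (prod_topology P P)
    {w \<in> topspace (prod_topology P P). (s, t) \<in> secure_replies P V Y A F C \<phi> (fst w) (snd w)}"
proof -
  let ?Q = "prod_topology P P"
  have proj: "continuous_map U P (\<lambda>w. fst (h w))" "continuous_map U P (\<lambda>w. snd (h w))"
    if "continuous_map U ?Q h" for U :: "'u topology" and h
    using continuous_map_fst_of[OF that] continuous_map_snd_of[OF that] by (simp_all add: o_def)
  have A_open: "openin ?Q {w \<in> topspace ?Q. fst w \<in> {p \<in> topspace P. s \<in> A p}}"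
    using A st by (intro openin_continuous_map_preimage[OF continuous_map_fst])
      (auto simp: open_lower_sections_def)
  have F_open: "openin ?Q {w \<in> topspace ?Q. snd w \<in> {q \<in> topspace P. t \<in> F q}}"
    using F st by (intro openin_continuous_map_preimage[OF continuous_map_snd])
      (auto simp: open_lower_sections_def)
  define Gr where "Gr = prod_topology P V closure_of (SIGMA p : topspace P. A p)"
  define S where "S = {wu \<in> topspace (prod_topology ?Q V). (fst (fst wu), snd wu) \<in> Gr}"
  have S: "closedin (prod_topology ?Q V) S"
    unfolding S_def Gr_def
    by (rule closedin_continuous_map_preimage[OF _ closedin_closure_of])
       (intro continuous_map_pairedI proj continuous_map_fst continuous_map_snd)
  define M where "M = {v \<in> topspace (prod_topology P (prod_topology P V)).
      (\<lambda>(p, q, u). \<phi> p s q t u) v \<inter> Y interior_of C (fst v) \<noteq> {}}"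
  have "openin (prod_topology P (prod_topology P V)) M"
    unfolding M_def by (rule openin_meets_interior[OF Y \<phi> C continuous_map_fst])
  then have W: "openin (prod_topology ?Q V)
      {wu \<in> topspace (prod_topology ?Q V). (fst (fst wu), snd (fst wu), snd wu) \<in> M}"
    by (rule openin_continuous_map_preimage[rotated])
       (intro continuous_map_pairedI proj continuous_map_fst continuous_map_snd)
  have "{w \<in> topspace ?Q. (s, t) \<in> secure_replies P V Y A F C \<phi> (fst w) (snd w)} =
      {w \<in> topspace ?Q. fst w \<in> {p \<in> topspace P. s \<in> A p}} \<inter>
      {w \<in> topspace ?Q. snd w \<in> {q \<in> topspace P. t \<in> F q}} \<inter>
      {w \<in> topspace ?Q. \<forall>u. (w, u) \<in> S \<longrightarrow> (w, u) \<in>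
        {wu \<in> topspace (prod_topology ?Q V). (fst (fst wu), snd (fst wu), snd wu) \<in> M}}"
    by (auto simp: secure_replies_def S_def M_def graph_closure_def Gr_def)
  with A_open F_open openin_fibre_subset[OF V S W] show ?thesis
    by (simp add: openin_Int)
qed

text \<open>
  An intersection of the convex set \<open>A p \<times> F q\<close> with one convex set for each \<open>u\<close>.
\<close>

lemma convex_secure_replies:
  assumes Y: "tvs_topology Y" and C: "convex (C p)" "cone (C p)" "C p \<subseteq> topspace Y"
    and X: "convex (topspace V)" and A: "convex (A p)" "A p \<subseteq> topspace V"
    and F: "convex (F q)" "F q \<subseteq> topspace V"
    and \<phi>: "\<And>u. u \<in> topspace V \<Longrightarrow> natural_quasi_concave (topspace V \<times> topspace V)
              (Y interior_of C p) (\<lambda>(s, t). \<phi> p s q t u)"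
  shows "convex (secure_replies P V Y A F C \<phi> p q)"
proof -
  have "secure_replies P V Y A F C \<phi> p q = (A p \<times> F q) \<inter>
      (\<Inter>u\<in>graph_closure P V A p.
         {k \<in> topspace V \<times> topspace V. (\<lambda>(s, t). \<phi> p s q t u) k \<inter> Y interior_of C p \<noteq> {}})"
    using A(2) F(2) by (auto simp: secure_replies_def)
  moreover have "convex {k \<in> topspace V \<times> topspace V.
      (\<lambda>(s, t). \<phi> p s q t u) k \<inter> Y interior_of C p \<noteq> {}}" if "u \<in> graph_closure P V A p" for u
  proof (rule convex_meets_interior[OF Y C convex_Times[OF X X] \<phi>])
    show "u \<in> topspace V" using that by (simp add: graph_closure_def)
  qed
  ultimately show ?thesis
    by (simp only:) (intro convex_Int convex_Times[OF A(1) F(1)] convex_INT)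
qed

section \<open>Existence of a solution\<close>

theorem theorem8:
  fixes n :: nat
    and E :: "nat \<Rightarrow> 'e::real_vector topology"
    and Y :: "nat \<Rightarrow> 'y::real_vector topology"
    and X :: "nat \<Rightarrow> 'e set"
    and A F :: "nat \<Rightarrow> (nat \<Rightarrow> 'e) \<Rightarrow> 'e set"
    and C :: "nat \<Rightarrow> (nat \<Rightarrow> 'e) \<Rightarrow> 'y set"
    and f :: "nat \<Rightarrow> (nat \<Rightarrow> 'e) \<Rightarrow> (nat \<Rightarrow> 'e) \<Rightarrow> 'e \<Rightarrow> 'y set"
  assumes E: "\<And>i. i \<in> {1..n} \<Longrightarrow> locally_convex_topology (E i) \<and> Hausdorff_space (E i)"
    and X: "\<And>i. i \<in> {1..n} \<Longrightarrow> X i \<noteq> {} \<and> convex (X i) \<and> compactin (E i) (X i)"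
    and Y: "\<And>i. i \<in> {1..n} \<Longrightarrow> tvs_topology (Y i)"
    and A_corr: "\<And>i. i \<in> {1..n} \<Longrightarrow> correspondence (others n X i) (X i) (A i)"
    and F_corr: "\<And>i. i \<in> {1..n} \<Longrightarrow> correspondence (others n X i) (X i) (F i)"
    and C_corr: "\<And>i. i \<in> {1..n} \<Longrightarrow> correspondence (others n X i) (topspace (Y i)) (C i)"
    and C_cone: "\<And>i p. \<lbrakk>i \<in> {1..n}; p \<in> others n X i\<rbrakk> \<Longrightarrow>
        C i p \<noteq> {} \<and> C i p \<noteq> topspace (Y i) \<and> closedin (Y i) (C i p) \<and>
        convex (C i p) \<and> cone (C i p) \<and> Y i interior_of C i p \<noteq> {}"
    and f_corr: "\<And>i. i \<in> {1..n} \<Longrightarrow>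
        correspondence (profiles n X \<times> profiles n X \<times> X i) (topspace (Y i))
          (\<lambda>(x, y, u). f i x y u) \<and>
        nonempty_values (profiles n X \<times> profiles n X \<times> X i) (\<lambda>(x, y, u). f i x y u)"
    and a_A: "\<And>i. i \<in> {1..n} \<Longrightarrow>
        nonempty_values (others n X i) (A i) \<and> convex_values (others n X i) (A i) \<and>
        open_lower_sections (others_topology n E X i) (subtopology (E i) (X i)) (A i)"
    and a_F: "\<And>i. i \<in> {1..n} \<Longrightarrow>
        nonempty_values (others n X i) (F i) \<and> convex_values (others n X i) (F i) \<and>
        open_lower_sections (others_topology n E X i) (subtopology (E i) (X i)) (F i)"
    and b: "\<And>i s t. \<lbrakk>i \<in> {1..n}; s \<in> X i; t \<in> X i\<rbrakk> \<Longrightarrow>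
        lower_semicontinuous
          (prod_topology (others_topology n E X i)
            (prod_topology (others_topology n E X i) (subtopology (E i) (X i))))
          (Y i) (\<lambda>(p, q, u). f i (p(i := s)) (q(i := t)) u)"
    and c: "\<And>i. i \<in> {1..n} \<Longrightarrow>
        upper_semicontinuous (others_topology n E X i) (Y i)
          (\<lambda>p. topspace (Y i) - uminus ` (Y i interior_of C i p))"
    and d: "\<And>i p q. \<lbrakk>i \<in> {1..n}; p \<in> others n X i; q \<in> others n X i\<rbrakk> \<Longrightarrow>
        \<exists>(s, t) \<in> A i p \<times> F i q.
          \<forall>u \<in> graph_closure (others_topology n E X i) (subtopology (E i) (X i)) (A i) p.
            f i (p(i := s)) (q(i := t)) u \<inter> (Y i interior_of C i p) \<noteq> {}"
    and e: "\<And>i p q u. \<lbrakk>i \<in> {1..n}; p \<in> others n X i; q \<in> others n X i; u \<in> X i\<rbrakk> \<Longrightarrow>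
        natural_quasi_concave (X i \<times> X i) (Y i interior_of C i p)
          (\<lambda>(s, t). f i (p(i := s)) (q(i := t)) u)"
  shows "\<exists>(x, y) \<in> profiles n X \<times> profiles n X.
      \<forall>i \<in> {1..n}.
        x i \<in> A i (drop_coord n i x) \<and>
        y i \<in> F i (drop_coord n i y) \<and>
        (\<forall>u \<in> A i (drop_coord n i x). f i x y u \<inter> C i (drop_coord n i x) \<noteq> {})"
proof -
  define I where "I = {1..n}"
  define P where "P i = others_topology n E X i" for i
  define V where "V i = subtopology (E i) (X i)" for i
  define R where "R i = secure_replies (P i) (V i) (Y i) (A i) (F i) (C i)
      (\<lambda>p s q t u. f i (p(i := s)) (q(i := t)) u)" for i
  define T where "T i = prod_topology (E i) (E i)" for i
  \<comment> \<open>Both strategies of player \<open>i\<close> form one variable, in which the values of \<open>R i\<close> are convex.\<close>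
  define Z where "Z i = X i \<times> X i" for i
  \<comment> \<open>The strategies of the players other than \<open>i\<close>, in the first and in the second profile.\<close>
  define rest1 rest2 :: "nat \<Rightarrow> (nat \<Rightarrow> 'e \<times> 'e) \<Rightarrow> nat \<Rightarrow> 'e"
    where "rest1 i w = (\<lambda>j\<in>I - {i}. fst (w j))" and "rest2 i w = (\<lambda>j\<in>I - {i}. snd (w j))" for i w
  define K where "K = product_topology (\<lambda>i. subtopology (T i) (Z i)) I"
  have topV: "topspace (V i) = X i" if "i \<in> I" for i
    using X[of i] that compactin_subset_topspace by (fastforce simp: V_def I_def)
  have topP: "topspace (P i) = others n X i" for i
    unfolding P_def others_topology_def others_def topspace_product_topology o_def
    by (rule PiE_cong) (use topV in \<open>auto simp: V_def I_def\<close>)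
  have subT: "subtopology (T i) (Z i) = prod_topology (V i) (V i)" for i
    by (simp add: T_def Z_def V_def subtopology_Times)
  have topK: "topspace K = Pi\<^sub>E I Z"
    unfolding K_def topspace_product_topology o_def subT topspace_prod_topology
    by (rule PiE_cong) (use topV in \<open>auto simp: Z_def\<close>)
  have rest: "rest1 i w \<in> others n X i" "rest2 i w \<in> others n X i" if "w \<in> Pi\<^sub>E I Z" for i w
    using that by (auto simp: rest1_def rest2_def others_def I_def Z_def PiE_iff mem_Times_iff)
  have rest_cont: "continuous_map K (prod_topology (P i) (P i)) (\<lambda>w. (rest1 i w, rest2 i w))" for i
  proof -
    have coord: "continuous_map K (prod_topology (V j) (V j)) (\<lambda>w. w j)" if "j \<in> I" for j
      using continuous_map_product_projection[OF that, of "\<lambda>i. subtopology (T i) (Z i)"]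
      by (simp add: K_def subT)
    have "continuous_map K (V j) (\<lambda>w. fst (w j))" "continuous_map K (V j) (\<lambda>w. snd (w j))"
      if "j \<in> I" for j
      using continuous_map_fst_of[OF coord[OF that]] continuous_map_snd_of[OF coord[OF that]]
      by (simp_all add: o_def)
    then have "continuous_map K (P i) (rest1 i)" "continuous_map K (P i) (rest2 i)"
      unfolding P_def others_topology_def continuous_map_componentwise
      by (auto simp: rest1_def rest2_def I_def V_def)
    then show ?thesis by (simp add: continuous_map_pairedI)
  qed
  have "\<exists>w\<in>Pi\<^sub>E I Z. \<forall>i\<in>I. w i \<in> R i (rest1 i w) (rest2 i w)"
  proof (rule collective_fixed_point[where T = T])
    show "finite I" by (simp add: I_def)
  next
    fix i assume "i \<in> I"
    then show "tvs_topology (T i) \<and> Hausdorff_space (T i)"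
      using E[of i] by (simp add: I_def T_def tvs_topology_prod Hausdorff_space_prod_topology
          locally_convex_topology_def)
  next
    fix i assume "i \<in> I"
    then show "Z i \<noteq> {} \<and> convex (Z i) \<and> compactin (T i) (Z i)"
      using X[of i] by (simp add: I_def T_def Z_def convex_Times compactin_Times)
  next
    fix i w assume iI: "i \<in> I" and w: "w \<in> Pi\<^sub>E I Z"
    then have i: "i \<in> {1..n}" by (simp add: I_def)
    let ?p = "rest1 i w" and ?q = "rest2 i w"
    note pq = rest[OF w, of i]
    have AF: "A i ?p \<subseteq> X i" "F i ?q \<subseteq> X i" "convex (A i ?p)" "convex (F i ?q)"
      using A_corr[OF i] F_corr[OF i] a_A[OF i] a_F[OF i] pq
      by (auto simp: correspondence_def convex_values_def)
    have "R i ?p ?q \<noteq> {}"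
      using d[OF i pq] by (fastforce simp: R_def secure_replies_def P_def V_def)
    moreover have "R i ?p ?q \<subseteq> Z i"
      using AF by (auto simp: R_def secure_replies_def Z_def)
    moreover have "convex (R i ?p ?q)"
      unfolding R_def
    proof (rule convex_secure_replies[OF Y[OF i]])
      show "convex (C i ?p)" "cone (C i ?p)" "C i ?p \<subseteq> topspace (Y i)"
        using C_cone[OF i pq(1)] C_corr[OF i] pq by (auto simp: correspondence_def)
    qed (use AF X[OF i] e[OF i pq] topV[OF iI] in auto)
    ultimately show "R i ?p ?q \<noteq> {} \<and> R i ?p ?q \<subseteq> Z i \<and> convex (R i ?p ?q)" by blast
  next
    fix i z assume iI: "i \<in> I" and z: "z \<in> Z i"
    then have i: "i \<in> {1..n}" by (simp add: I_def)
    obtain s t where st: "z = (s, t)" "s \<in> X i" "t \<in> X i" using z by (auto simp: Z_def)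
    have "openin (prod_topology (P i) (P i))
        {v \<in> topspace (prod_topology (P i) (P i)). (s, t) \<in> R i (fst v) (snd v)}"
      unfolding R_def
    proof (rule openin_secure_replies[OF Y[OF i]])
      show "compact_space (V i)" using X[OF i] by (simp add: V_def compact_space_subtopology)
    qed (use a_A[OF i] a_F[OF i] b[OF i st(2,3)] c[OF i] st topV[OF iI] in \<open>auto simp: P_def V_def\<close>)
    from openin_continuous_map_preimage[OF rest_cont this]
    show "openin (product_topology (\<lambda>i. subtopology (T i) (Z i)) I)
        {w \<in> Pi\<^sub>E I Z. z \<in> R i (rest1 i w) (rest2 i w)}"
      using rest by (simp add: K_def[symmetric] topK topP st(1) cong: conj_cong)
  qed
  then obtain w where w: "w \<in> Pi\<^sub>E I Z" and fp: "\<And>i. i \<in> I \<Longrightarrow> w i \<in> R i (rest1 i w) (rest2 i w)"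
    by blast
  define x y where "x = (\<lambda>i\<in>I. fst (w i))" and "y = (\<lambda>i\<in>I. snd (w i))"
  have "x \<in> profiles n X" "y \<in> profiles n X"
    using w by (auto simp: x_def y_def profiles_def I_def Z_def PiE_iff mem_Times_iff)
  moreover have "x i \<in> A i (drop_coord n i x) \<and> y i \<in> F i (drop_coord n i y) \<and>
      (\<forall>u\<in>A i (drop_coord n i x). f i x y u \<inter> C i (drop_coord n i x) \<noteq> {})" if i: "i \<in> {1..n}" for i
  proof -
    have iI: "i \<in> I" using i by (simp add: I_def)
    have drop: "drop_coord n i x = rest1 i w" "drop_coord n i y = rest2 i w"
      by (auto simp: drop_coord_def x_def y_def rest1_def rest2_def I_def restrict_def)
    have upd: "(rest1 i w)(i := fst (w i)) = x" "(rest2 i w)(i := snd (w i)) = y"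
      using iI by (auto simp: x_def y_def rest1_def rest2_def)
    have "A i (rest1 i w) \<subseteq> graph_closure (P i) (V i) (A i) (rest1 i w)"
      using rest[OF w] A_corr[OF i] topP topV[OF iI]
      by (intro subset_graph_closure) (auto simp: correspondence_def)
    then have "f i x y u \<inter> C i (rest1 i w) \<noteq> {}" if "u \<in> A i (rest1 i w)" for u
      using fp[OF iI] that upd interior_of_subset[of "Y i" "C i (rest1 i w)"]
      by (fastforce simp: R_def secure_replies_def)
    moreover have "x i \<in> A i (rest1 i w)" "y i \<in> F i (rest2 i w)"
      using fp[OF iI] iI by (auto simp: R_def secure_replies_def x_def y_def)
    ultimately show ?thesis by (simp add: drop)
  qed
  ultimately show ?thesis by blast
qed

end
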